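(* Let $G$ be a finite graph on vertex set $V$, and let $V = V_1 \sqcup V_2 \sqcup \dots \sqcup V_m$ be a partition of $V$. Let $n \ge m+1$ and $q \ge 2$ be integers such that $|V_j| \ge q-1$ for all $j$, $|V| \le (q-1)n+1$, and such that there is no $\mathfrak S_q$-equivariant continuous map $\mathrm{I}(G)^{*q}_\Delta \to S(W_q^{\oplus n})$. Then $G$ admits an almost fair splitting by $q$ independent sets.
   Context: A set of vertices is independent if it contains no two endpoints of an edge; $\mathrm{I}(G)$ is the simplicial complex of all independent sets of $G$ (the independence complex), regarded as a topological space via geometric realization. For a simplicial complex $K$, the $q$-fold deleted join $K^{*q}_\Delta$ is the subcomplex of the $q$-fold join $K * \dots * K$ (of $q$ disjoint copies of $K$) consisting of faces $\sigma_1 * \dots * \sigma_q$ with $\sigma_i \in K$ pairwise disjoint as subsets of the vertex set of $K$ (empty faces allowed); its points are written $\lambda_1 x_1 + \dots + \lambda_q x_q$ with $\lambda_i \ge 0$, $\sum \lambda_i = 1$, $x_i$ in the $i$-th copy. The symmetric group $\mathfrak S_q$ acts on $K^{*q}_\Delta$ by permuting the $q$ join factors. $W_q = \{(y_1, \dots, y_q) \in \mathbb{R}^q : \sum y_i = 0\}$ with $\mathfrak S_q$ permuting coordinates; $W_q^{\oplus n}$ is the $n$-fold direct sum with the diagonal action, and $S(W_q^{\oplus n})$ its unit sphere. Given the partition, pairwise disjoint sets $S_1, \dots, S_q \subseteq V$ form an almost fair splitting if $|S_i \cap V_j| \ge \lfloor \frac{|V_j|+1}{q} \rfloor - 1$ for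 all $i,j$ and $|V_j \setminus \bigcup_i S_i| \le q-1$ for all $j$. *)

theory Defs
  imports "HOL-Analysis.Analysis" "HOL-Combinatorics.Permutations"
begin

definition finite_graph :: "'a set \<Rightarrow> 'a set set \<Rightarrow> bool" where
  "finite_graph V E \<longleftrightarrow> finite V \<and> (\<forall>e\<in>E. e \<subseteq> V \<and> card e = 2)"

definition independent_set :: "'a set set \<Rightarrow> 'a set \<Rightarrow> bool" where
  "independent_set E S \<longleftrightarrow> (\<forall>u\<in>S. \<forall>v\<in>S. {u, v} \<notin> E)"

definition independence_complex :: "'a set \<Rightarrow> 'a set set \<Rightarrow> 'a set set" where
  "independence_complex V E = {S. S \<subseteq> V \<and> independent_set E S}"

text \<open>
  The face \<open>\<sigma>\<^sub>0 * \<dots> * \<sigma>\<^sub>q\<^sub>-\<^sub>1\<close> of the \<open>q\<close>-fold join is encoded as the disjoint union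
  \<open>{(i, v). i < q \<and> v \<in> \<sigma>\<^sub>i}\<close>; the vertex \<open>(i, v)\<close> is the copy of \<open>v\<close> in the \<open>i\<close>-th factor.
\<close>
definition deleted_join :: "nat \<Rightarrow> 'a set set \<Rightarrow> (nat \<times> 'a) set set" where
  "deleted_join q K =
     {(SIGMA i:{..<q}. \<sigma> i) | \<sigma>. (\<forall>i<q. \<sigma> i \<in> K) \<and> disjoint_family_on \<sigma> {..<q}}"

text \<open>
  Points are given by barycentric coordinates, and the topology is that of a subspace of the product
  space \<open>'v \<Rightarrow> real\<close>. For a complex with finitely many vertices this is the usual topology.
  In the realization of a deleted join, the point \<open>\<lambda>\<^sub>0 x\<^sub>0 + \<dots> + \<lambda>\<^sub>q\<^sub>-\<^sub>1 x\<^sub>q\<^sub>-\<^sub>1\<close> has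
  coordinate \<open>\<lambda>\<^sub>i * x\<^sub>i v\<close> at the vertex \<open>(i, v)\<close>.
\<close>
definition geometric_realization :: "'v set set \<Rightarrow> ('v \<Rightarrow> real) set" where
  "geometric_realization K =
     {x. (\<forall>v. 0 \<le> x v) \<and> {v. x v \<noteq> 0} \<in> K \<and> sum x {v. x v \<noteq> 0} = 1}"

definition permute_factors :: "(nat \<Rightarrow> nat) \<Rightarrow> (nat \<times> 'a \<Rightarrow> real) \<Rightarrow> (nat \<times> 'a \<Rightarrow> real)" where
  "permute_factors \<pi> x = (\<lambda>(i, v). x (inv \<pi> i, v))"

text \<open>
  Vectors of length \<open>q\<close> are functions on \<open>nat\<close> vanishing outside \<open>{..<q}\<close>; an element \<open>z\<close> of the
  \<open>n\<close>-fold direct sum has components \<open>z k\<close> for \<open>k < n\<close> and vanishes for \<open>k \<ge> n\<close>.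
\<close>
definition W_rep :: "nat \<Rightarrow> (nat \<Rightarrow> real) set" where
  "W_rep q = {y. (\<forall>i\<ge>q. y i = 0) \<and> (\<Sum>i<q. y i) = 0}"

definition W_rep_sum :: "nat \<Rightarrow> nat \<Rightarrow> (nat \<Rightarrow> nat \<Rightarrow> real) set" where
  "W_rep_sum q n = {z. (\<forall>k<n. z k \<in> W_rep q) \<and> (\<forall>k\<ge>n. \<forall>i. z k i = 0)}"

definition W_sphere :: "nat \<Rightarrow> nat \<Rightarrow> (nat \<Rightarrow> nat \<Rightarrow> real) set" where
  "W_sphere q n = {z \<in> W_rep_sum q n. sqrt (\<Sum>k<n. \<Sum>i<q. (z k i)\<^sup>2) = 1}"

definition permute_coords :: "(nat \<Rightarrow> nat) \<Rightarrow> (nat \<Rightarrow> nat \<Rightarrow> real) \<Rightarrow> (nat \<Rightarrow> nat \<Rightarrow> real)" where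
  "permute_coords \<pi> z = (\<lambda>k i. z k (inv \<pi> i))"

definition sym_equivariant_map ::
  "nat \<Rightarrow> ((nat \<Rightarrow> nat) \<Rightarrow> 'x \<Rightarrow> 'x) \<Rightarrow> 'x::topological_space set \<Rightarrow>
   ((nat \<Rightarrow> nat) \<Rightarrow> 'y \<Rightarrow> 'y) \<Rightarrow> 'y::topological_space set \<Rightarrow> ('x \<Rightarrow> 'y) \<Rightarrow> bool" where
  "sym_equivariant_map q actX X actY Y f \<longleftrightarrow>
     continuous_on X f \<and> f \<in> X \<rightarrow> Y \<and>
     (\<forall>\<pi>. \<pi> permutes {..<q} \<longrightarrow> (\<forall>x\<in>X. f (actX \<pi> x) = actY \<pi> (f x)))"

definition almost_fair_splitting ::
  "'a set \<Rightarrow> nat \<Rightarrow> (nat \<Rightarrow> 'a set) \<Rightarrow> nat \<Rightarrow> (nat \<Rightarrow> 'a set) \<Rightarrow> bool" where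
  "almost_fair_splitting V m P q S \<longleftrightarrow>
     (\<forall>i<q. S i \<subseteq> V) \<and> disjoint_family_on S {..<q} \<and>
     (\<forall>i<q. \<forall>j<m. int (card (S i \<inter> P j)) \<ge> \<lfloor>(real (card (P j)) + 1) / real q\<rfloor> - 1) \<and>
     (\<forall>j<m. card (P j - (\<Union>i<q. S i)) \<le> q - 1)"

end

theory Submission
  imports Defs
begin

text \<open>
  Assuming that there is no almost fair splitting, an equivariant map is built on the barycentric
  subdivision of the deleted join. For a face \<open>F = (S\<^sub>0, \<dots>, S\<^sub>q\<^sub>-\<^sub>1)\<close> let \<open>I\<^sub>j\<close> be the set of those
  \<open>i\<close> with \<open>|S\<^sub>i \<inter> V\<^sub>j| \<ge> \<lfloor>(|V\<^sub>j| + 1) / q\<rfloor>\<close>. The indicator vector of \<open>I\<^sub>j\<close>, modulo constants, is the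
  \<open>j\<close>-th coordinate for \<open>j < m\<close>. Since \<open>I\<^sub>j\<close> increases along chains, no cancellation is possible, so
  all \<open>m\<close> coordinates vanish only on chains of faces for which every \<open>I\<^sub>j\<close> is empty or everything.
  On such chains \<open>|F| - (q - 1) |{j. I\<^sub>j is everything}|\<close> is strictly increasing, because \<open>I\<^sub>j\<close> can
  only jump from empty to everything when at least \<open>q\<close> vertices of \<open>V\<^sub>j\<close> are added. It lies between \<open>1\<close>
  and \<open>|V| - m (q - 1) \<le> (q - 1) (n - m) + 1\<close>, and the upper bound is attained only by almost fair
  splittings. Hence these ranks split into \<open>n - m\<close> blocks of length \<open>q - 1\<close>, one for each remaining
  copy of \<open>W\<^sub>q\<close>; fewer than \<open>q\<close> unit vectors never have a positive combination that is constant.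
\<close>

section \<open>Faces of the deleted join as sets of pairs\<close>

lemma independent_set_subset:
  "independent_set E S \<Longrightarrow> S' \<subseteq> S \<Longrightarrow> independent_set E S'"
  by (auto simp: independent_set_def)

text \<open>A face is recovered from its slices over the indices \<open>i\<close>, and these slices
  are pairwise disjoint exactly when \<open>snd\<close> is injective on the face.\<close>

lemma mem_deleted_join_independence_complex:
  "F \<in> deleted_join q (independence_complex V E) \<longleftrightarrow>
     F \<subseteq> {..<q} \<times> V \<and> (\<forall>i<q. independent_set E (F `` {i})) \<and> inj_on snd F"
  (is "?L \<longleftrightarrow> ?R")
proof
  assume ?L
  then obtain \<sigma> where s: "F = (SIGMA i:{..<q}. \<sigma> i)"
    "\<forall>i<q. \<sigma> i \<in> independence_complex V E" "disjoint_family_on \<sigma> {..<q}"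
    by (auto simp: deleted_join_def)
  have "F `` {i} = \<sigma> i" if "i < q" for i
    using that s(1) by auto
  moreover have "inj_on snd F"
    using s(1,3) unfolding inj_on_def disjoint_family_on_def by force
  ultimately show ?R
    using s(1,2) by (auto simp: independence_complex_def)
next
  assume R: ?R
  have "F = (SIGMA i:{..<q}. F `` {i})"
    using R by auto
  moreover have "disjoint_family_on (\<lambda>i. F `` {i}) {..<q}"
    using R unfolding disjoint_family_on_def inj_on_def by fastforce
  moreover have "\<forall>i<q. F `` {i} \<in> independence_complex V E"
    using R by (auto simp: independence_complex_def)
  ultimately show ?L
    unfolding deleted_join_def by (intro CollectI exI[of _ "\<lambda>i. F `` {i}"]) auto
qed

text \<open>On the chain, \<open>i'\<close> lies in \<open>A F\<close> only if \<open>i\<close>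
  does: below \<open>G\<close> monotonicity keeps \<open>i'\<close> out, above \<open>G\<close> it
  keeps \<open>i\<close> in. The inequality is strict at \<open>F = G\<close>.\<close>

lemma monotone_indicator_combination_not_constant:
  fixes w :: "'f set \<Rightarrow> real"
  assumes "finite C" and pos: "\<And>F. F \<in> C \<Longrightarrow> 0 < w F"
    and chain: "\<And>F F'. F \<in> C \<Longrightarrow> F' \<in> C \<Longrightarrow> F \<subseteq> F' \<or> F' \<subseteq> F"
    and mono: "\<And>F F'. F \<in> C \<Longrightarrow> F' \<in> C \<Longrightarrow> F \<subseteq> F' \<Longrightarrow> A F \<subseteq> A F'"
    and G: "G \<in> C" "i \<in> A G" "i' \<notin> A G"
  shows "(\<Sum>F\<in>C. w F * of_bool (i' \<in> A F)) < (\<Sum>F\<in>C. w F * of_bool (i \<in> A F))"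
proof (rule sum_strict_mono_ex1)
  show "\<forall>F\<in>C. w F * of_bool (i' \<in> A F) \<le> w F * of_bool (i \<in> A F)"
  proof
    fix F assume F: "F \<in> C"
    have "i' \<in> A F \<Longrightarrow> i \<in> A F"
      using chain[OF F G(1)] mono[OF F G(1)] mono[OF G(1) F] G by auto
    then show "w F * of_bool (i' \<in> A F) \<le> w F * of_bool (i \<in> A F)"
      using pos[OF F] by auto
  qed
  show "\<exists>F\<in>C. w F * of_bool (i' \<in> A F) < w F * of_bool (i \<in> A F)"
    using G pos by (intro bexI[of _ G]) auto
qed fact

section \<open>Permutations acting on faces\<close>

definition permute_face :: "(nat \<Rightarrow> nat) \<Rightarrow> (nat \<times> 'a) set \<Rightarrow> (nat \<times> 'a) set" where
  "permute_face \<pi> F = map_prod \<pi> id ` F"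

lemma mem_permute_face:
  assumes "\<pi> permutes S"
  shows "(i, v) \<in> permute_face \<pi> F \<longleftrightarrow> (inv \<pi> i, v) \<in> F"
proof
  show "(i, v) \<in> permute_face \<pi> F \<Longrightarrow> (inv \<pi> i, v) \<in> F"
    using permutes_inverses[OF assms] by (auto simp: permute_face_def)
  show "(inv \<pi> i, v) \<in> F \<Longrightarrow> (i, v) \<in> permute_face \<pi> F"
    unfolding permute_face_def
    by (rule image_eqI[of _ _ "(inv \<pi> i, v)"]) (simp_all add: permutes_inverses[OF assms])
qed

lemma Image_permute_face:
  assumes "\<pi> permutes S"
  shows "permute_face \<pi> F `` {i} = F `` {inv \<pi> i}"
  by (auto simp: mem_permute_face[OF assms])

text \<open>Pulling coordinates back along \<open>inv \<pi>\<close> cancels pushing vertices forward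
  along \<open>\<pi>\<close>, so points and faces are permuted compatibly.\<close>

lemma permute_factors_map_prod:
  assumes "\<pi> permutes S"
  shows "permute_factors \<pi> x (map_prod \<pi> id p) = x p"
  using permutes_inverses[OF assms] by (cases p) (simp add: permute_factors_def)

lemma inj_map_prod_permutes:
  assumes "\<pi> permutes S"
  shows "inj (map_prod \<pi> id)"
  using permutes_inj[OF assms] by (simp add: prod.inj_map)

section \<open>Ranks and labels in a graph without almost fair splitting\<close>

text \<open>The setting of the proof by contradiction. The numbering \<open>pos\<close> serves to
  choose one vertex of each nonempty face canonically.\<close>

locale partitioned_graph =
  fixes V :: "'a set" and E :: "'a set set" and P :: "nat \<Rightarrow> 'a set" and m n q :: nat
    and pos :: "'a \<Rightarrow> nat"
  assumes finV: "finite V"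
    and cover: "(\<Union>j<m. P j) = V" and disj: "disjoint_family_on P {..<m}"
    and n_ge: "n \<ge> m + 1" and q_ge: "q \<ge> 2"
    and large: "\<forall>j<m. card (P j) \<ge> q - 1"
    and cardV: "card V \<le> (q - 1) * n + 1"
    and pos_inj: "inj_on pos V"
    and no_splitting: "\<not> (\<exists>S. (\<forall>i<q. independent_set E (S i)) \<and> almost_fair_splitting V m P q S)"
begin

definition K :: "(nat \<times> 'a) set set" where
  "K = deleted_join q (independence_complex V E)"

text \<open>The floor in the splitting condition, as a natural number; an almost fair splitting
  needs all counts to be at least \<open>thr j - 1\<close>.\<close>

definition thr :: "nat \<Rightarrow> nat" where
  "thr j = (card (P j) + 1) div q"

definition cnt :: "nat \<Rightarrow> nat \<Rightarrow> (nat \<times> 'a) set \<Rightarrow> nat" where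
  "cnt j i F = card (F `` {i} \<inter> P j)"

definition big :: "nat \<Rightarrow> (nat \<times> 'a) set \<Rightarrow> nat set" where
  "big j F = {i. i < q \<and> thr j \<le> cnt j i F}"

definition uniform :: "(nat \<times> 'a) set \<Rightarrow> bool" where
  "uniform F \<longleftrightarrow> (\<forall>j<m. big j F = {} \<or> big j F = {..<q})"

text \<open>The correction \<open>q - 1\<close> gives both kinds of uniform faces in
  \<open>K\<close> the same upper bound \<open>card (P j) - (q - 1)\<close>.\<close>

definition slice_rank :: "nat \<Rightarrow> (nat \<times> 'a) set \<Rightarrow> int" where
  "slice_rank j F = int (\<Sum>i<q. cnt j i F) - (if big j F = {..<q} then int (q - 1) else 0)"

definition rank :: "(nat \<times> 'a) set \<Rightarrow> int" where
  "rank F = (\<Sum>j<m. slice_rank j F)"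

text \<open>The choice of the first vertex looks at vertices of the graph only and not at factor
  indices, so it commutes with permuting the factors.\<close>

definition leader :: "(nat \<times> 'a) set \<Rightarrow> nat set" where
  "leader F = {i. \<exists>v. (i, v) \<in> F \<and> (\<forall>p\<in>F. pos v \<le> pos (snd p))}"

text \<open>The shift in \<open>rank F - 1\<close> makes block 0 start at rank 1, the least possible
  rank of a nonempty uniform face.\<close>

definition label :: "nat \<Rightarrow> (nat \<times> 'a) set \<Rightarrow> nat set" where
  "label k F =
     (if k < m then big k F
      else if uniform F \<and> (rank F - 1) div int (q - 1) = int (k - m) then leader F else {})"

section \<open>Faces and their counts in the classes\<close>

lemma K_iff: "F \<in> K \<longleftrightarrow>
    F \<subseteq> {..<q} \<times> V \<and> (\<forall>i<q. independent_set E (F `` {i})) \<and> inj_on snd F"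
  by (simp add: K_def mem_deleted_join_independence_complex)

lemma K_unique: "F \<in> K \<Longrightarrow> (i, v) \<in> F \<Longrightarrow> (i', v) \<in> F \<Longrightarrow> i = i'"
  unfolding K_iff inj_on_def by force

lemma K_subset: "F \<in> K \<Longrightarrow> F' \<subseteq> F \<Longrightarrow> F' \<in> K"
  unfolding K_iff
  by (meson Image_mono independent_set_subset inj_on_subset order_refl subset_trans)

lemma finite_K: "finite K"
  by (rule finite_subset[of _ "Pow ({..<q} \<times> V)"]) (use finV in \<open>auto simp: K_iff\<close>)

lemma finite_P: "j < m \<Longrightarrow> finite (P j)"
  using cover finV by (auto intro: finite_subset)

lemma thr_pos: "j < m \<Longrightarrow> 1 \<le> thr j"
proof -
  assume "j < m"
  then have "q \<le> card (P j) + 1" using large by force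
  then show ?thesis unfolding thr_def using q_ge by (simp add: div_greater_zero_iff Suc_leI)
qed

lemma q_thr_le: "q * thr j \<le> card (P j) + 1"
  unfolding thr_def by simp

lemma cnt_mono: "j < m \<Longrightarrow> F \<subseteq> F' \<Longrightarrow> cnt j i F \<le> cnt j i F'"
  unfolding cnt_def using finite_P by (intro card_mono) auto

lemma big_mono: "j < m \<Longrightarrow> F \<subseteq> F' \<Longrightarrow> big j F \<subseteq> big j F'"
  unfolding big_def using cnt_mono by (blast intro: order_trans)

lemma sum_cnt:
  assumes "F \<in> K" "j < m"
  shows "(\<Sum>i<q. cnt j i F) = card ((\<Union>i<q. F `` {i}) \<inter> P j)"
proof -
  have "card (\<Union>i<q. F `` {i} \<inter> P j) = (\<Sum>i<q. card (F `` {i} \<inter> P j))"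
    using assms finite_P by (intro card_UN_disjoint) (auto dest: K_unique)
  then show ?thesis by (simp add: cnt_def)
qed

text \<open>If \<open>big j F\<close> is empty, each count is at most \<open>thr j - 1\<close>; the
  strict version serves factors that miss even this fair share.\<close>

lemma sum_cnt_empty:
  assumes "j < m" "big j F = {}"
  shows "(\<Sum>i<q. cnt j i F) \<le> q * (thr j - 1)"
    and "i < q \<Longrightarrow> cnt j i F < thr j - 1 \<Longrightarrow> (\<Sum>i<q. cnt j i F) < q * (thr j - 1)"
proof -
  have le: "cnt j i F \<le> thr j - 1" if "i < q" for i
    using assms that unfolding big_def by force
  show "(\<Sum>i<q. cnt j i F) \<le> q * (thr j - 1)"
    using sum_mono[of "{..<q}" "\<lambda>i. cnt j i F" "\<lambda>i. thr j - 1"] le by simp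
  show "(\<Sum>i<q. cnt j i F) < q * (thr j - 1)" if "i < q" "cnt j i F < thr j - 1"
    using sum_strict_mono_ex1[of "{..<q}" "\<lambda>i. cnt j i F" "\<lambda>i. thr j - 1"] le that by auto
qed

lemma sum_cnt_full:
  assumes "big j F = {..<q}"
  shows "q * thr j \<le> (\<Sum>i<q. cnt j i F)"
proof -
  have "thr j \<le> cnt j i F" if "i < q" for i
    using assms that unfolding big_def by blast
  then show ?thesis
    using sum_mono[of "{..<q}" "\<lambda>i. thr j" "\<lambda>i. cnt j i F"] by simp
qed

section \<open>Growth of the rank along chains of uniform faces\<close>

lemma slice_rank_mono:
  assumes "uniform F" "uniform F'" "F \<subseteq> F'" "j < m"
  shows "slice_rank j F \<le> slice_rank j F'"
    and "(\<Sum>i<q. cnt j i F) < (\<Sum>i<q. cnt j i F') \<Longrightarrow> slice_rank j F < slice_rank j F'"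
proof -
  have q0: "{..<q} \<noteq> {}" using q_ge by (auto simp: lessThan_empty_iff)
  have le: "(\<Sum>i<q. cnt j i F) \<le> (\<Sum>i<q. cnt j i F')"
    using assms cnt_mono by (intro sum_mono) auto
  consider "big j F = {..<q}" "big j F' = {..<q}" | "big j F = {}" "big j F' = {}"
    | "big j F = {}" "big j F' = {..<q}"
    using assms(1,2,4) big_mono[OF assms(4,3)] q0 unfolding uniform_def by (metis subset_empty)
  then have *: "slice_rank j F \<le> slice_rank j F' \<and>
    ((\<Sum>i<q. cnt j i F) < (\<Sum>i<q. cnt j i F') \<longrightarrow> slice_rank j F < slice_rank j F')"
  proof cases
    \<comment> \<open>All counts pass from at most \<open>thr j - 1\<close> to at least
      \<open>thr j\<close>, so the total grows by at least \<open>q\<close>, one more than the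
      correction takes away.\<close>
    case 3
    have "(\<Sum>i<q. cnt j i F) \<le> q * (thr j - 1)"
      using sum_cnt_empty(1) 3 assms by auto
    moreover have "q * (thr j - 1) + q = q * thr j"
      using thr_pos[OF assms(4)] by (cases "thr j") auto
    ultimately have "(\<Sum>i<q. cnt j i F) + q \<le> (\<Sum>i<q. cnt j i F')"
      using sum_cnt_full[OF 3(2)] by linarith
    then show ?thesis
      using 3 q0 q_ge by (auto simp: slice_rank_def simp del: of_nat_sum)
  qed (use le q0 in \<open>auto simp: slice_rank_def simp del: of_nat_sum\<close>)
  then show "slice_rank j F \<le> slice_rank j F'"
    and "(\<Sum>i<q. cnt j i F) < (\<Sum>i<q. cnt j i F') \<Longrightarrow> slice_rank j F < slice_rank j F'"
    by auto
qed

text \<open>A vertex of \<open>F'\<close> outside \<open>F\<close> lies in some class, whose slice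
  rank grows strictly, while no other slice rank drops.\<close>

lemma rank_strict_mono:
  assumes "uniform F" "uniform F'" "F \<subset> F'" "F' \<in> K"
  shows "rank F < rank F'"
proof -
  obtain i v where iv: "(i, v) \<in> F'" "(i, v) \<notin> F"
    using assms(3) by auto
  then have i: "i < q" "v \<in> V" using assms(4) by (auto simp: K_iff)
  then obtain j where j: "j < m" "v \<in> P j" using cover by auto
  have "F `` {i} \<inter> P j \<subset> F' `` {i} \<inter> P j"
    using iv j assms(3) by auto
  then have "cnt j i F < cnt j i F'"
    unfolding cnt_def using finite_P[OF j(1)] by (intro psubset_card_mono) auto
  then have "(\<Sum>i<q. cnt j i F) < (\<Sum>i<q. cnt j i F')"
    using cnt_mono[OF j(1)] assms(3) i by (intro sum_strict_mono_ex1) auto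
  then have "slice_rank j F < slice_rank j F'"
    using slice_rank_mono(2) assms j by auto
  then show ?thesis
    unfolding rank_def using slice_rank_mono(1) assms j by (intro sum_strict_mono_ex1) auto
qed

text \<open>Comparison with the empty face, which is uniform of rank 0 because all thresholds are
  positive.\<close>

lemma rank_pos:
  assumes "F \<in> K" "uniform F" "F \<noteq> {}"
  shows "1 \<le> rank F"
proof -
  have big: "big j {} = {}" if "j < m" for j
    using thr_pos[OF that] by (auto simp: big_def cnt_def)
  have "{..<q} \<noteq> {}" using q_ge by (auto simp: lessThan_empty_iff)
  then have "rank {} = 0"
    using big by (auto simp: rank_def slice_rank_def cnt_def)
  moreover have "rank {} < rank F"
    using assms big by (intro rank_strict_mono) (auto simp: uniform_def)
  ultimately show ?thesis by simp
qed

section \<open>Upper bound for the rank\<close>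

text \<open>Otherwise the slices of \<open>F\<close> would be an almost fair splitting. Truncated
  subtraction is harmless here, as the sum counts vertices of \<open>P j\<close> without
  repetition.\<close>

lemma exists_unfair_class:
  assumes "F \<in> K"
  obtains j where "j < m"
    "(\<exists>i<q. cnt j i F < thr j - 1) \<or> q \<le> card (P j) - (\<Sum>i<q. cnt j i F)"
proof (rule ccontr)
  note unfair_class = that
  assume no: "\<not> thesis"
  have fair: "(\<forall>i<q. thr j - 1 \<le> cnt j i F) \<and> card (P j) - (\<Sum>i<q. cnt j i F) \<le> q - 1"
    if j: "j < m" for j
  proof -
    have "\<not> ((\<exists>i<q. cnt j i F < thr j - 1) \<or> q \<le> card (P j) - (\<Sum>i<q. cnt j i F))"
      using unfair_class[OF j] no by blast
    then show ?thesis using q_ge by force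
  qed
  have "almost_fair_splitting V m P q (\<lambda>i. F `` {i})"
    unfolding almost_fair_splitting_def
  proof (intro conjI allI impI)
    show "disjoint_family_on (\<lambda>i. F `` {i}) {..<q}"
      using assms by (auto simp: disjoint_family_on_def dest: K_unique)
    show "F `` {i} \<subseteq> V" for i
      using assms by (auto simp: K_iff)
    fix j assume j: "j < m"
    show "card (P j - (\<Union>i<q. F `` {i})) \<le> q - 1"
      using fair[OF j] sum_cnt[OF assms j] finite_P[OF j]
      by (simp add: card_Diff_subset_Int Int_commute)
    fix i assume i: "i < q"
    have "\<lfloor>(real (card (P j)) + 1) / real q\<rfloor> = int (thr j)"
      using floor_divide_of_nat_eq[of "card (P j) + 1" q, where ?'a = real]
      by (simp add: thr_def add.commute)
    then show "\<lfloor>(real (card (P j)) + 1) / real q\<rfloor> - 1 \<le> int (card (F `` {i} \<inter> P j))"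
      using fair[OF j] i thr_pos[OF j] unfolding cnt_def by force
  qed
  then show False
    using no_splitting assms by (auto simp: K_iff)
qed

text \<open>Each class contributes at most \<open>card (P j) - (q - 1)\<close>, an unfair one
  strictly less. The sum of these bounds is at most \<open>(q - 1) * (n - m) + 1\<close>, and
  strictness removes the final 1.\<close>

lemma rank_le:
  assumes "F \<in> K" "uniform F"
  shows "rank F \<le> int ((q - 1) * (n - m))"
proof -
  have q0: "{..<q} \<noteq> {}" using q_ge by (auto simp: lessThan_empty_iff)
  have le_card: "(\<Sum>i<q. cnt j i F) \<le> card (P j)" if "j < m" for j
    unfolding sum_cnt[OF assms(1) that] using finite_P[OF that] by (intro card_mono) auto
  \<comment> \<open>As \<open>q * thr j\<close> is at most \<open>card (P j) + 1\<close>, lowering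
    the threshold by one leaves room for \<open>q - 1\<close> further vertices.\<close>
  have q_thr: "q * (thr j - 1) + (q - 1) \<le> card (P j)" if "j < m" for j
  proof -
    have "q * (thr j - 1) + q = q * thr j"
      using thr_pos[OF that] by (cases "thr j") auto
    then show ?thesis using q_thr_le[of j] q_ge by linarith
  qed
  have le: "slice_rank j F \<le> int (card (P j)) - int (q - 1)" if j: "j < m" for j
  proof (cases "big j F = {..<q}")
    case True
    then show ?thesis using le_card[OF j] by (simp add: slice_rank_def del: of_nat_sum)
  next
    case False
    then have e: "big j F = {}" using assms j by (auto simp: uniform_def)
    have "(\<Sum>i<q. cnt j i F) + (q - 1) \<le> card (P j)"
      using sum_cnt_empty(1)[OF j e] q_thr[OF j] by linarith
    then show ?thesis
      using e q0 by (auto simp: slice_rank_def simp del: of_nat_sum)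
  qed
  obtain j where j: "j < m"
    and unfair: "(\<exists>i<q. cnt j i F < thr j - 1) \<or> q \<le> card (P j) - (\<Sum>i<q. cnt j i F)"
    using exists_unfair_class[OF assms(1)] .
  have less: "slice_rank j F < int (card (P j)) - int (q - 1)"
  proof (cases "big j F = {..<q}")
    case True
    have "thr j \<le> cnt j i F" if "i < q" for i
      using True that unfolding big_def by blast
    \<comment> \<open>A full class has no factor below its fair share, so it is unfair only by
      leaving at least \<open>q\<close> vertices over.\<close>
    then have "\<not> (\<exists>i<q. cnt j i F < thr j - 1)"
      by (meson diff_le_self le_trans not_less)
    then show ?thesis
      using unfair q_ge True by (auto simp: slice_rank_def simp del: of_nat_sum)
  next
    case False
    then have e: "big j F = {}" using assms j by (auto simp: uniform_def)
    have "(\<Sum>i<q. cnt j i F) + (q - 1) < card (P j)"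
      using unfair
    proof
      assume "\<exists>i<q. cnt j i F < thr j - 1"
      then have "(\<Sum>i<q. cnt j i F) < q * (thr j - 1)"
        using sum_cnt_empty(2)[OF j e] by blast
      then show ?thesis using q_thr[OF j] by linarith
    qed (use q_ge in linarith)
    then show ?thesis
      using e q0 by (auto simp: slice_rank_def simp del: of_nat_sum)
  qed
  have "rank F < (\<Sum>j<m. int (card (P j)) - int (q - 1))"
    unfolding rank_def using le less j by (intro sum_strict_mono_ex1) auto
  also have "\<dots> = int (card V) - int m * int (q - 1)"
  proof -
    have "card V = (\<Sum>j<m. card (P j))"
      unfolding cover[symmetric] using finite_P disj
      by (intro card_UN_disjoint) (auto simp: disjoint_family_on_def)
    then show ?thesis by (simp add: sum_subtractf)
  qed
  also have "\<dots> \<le> int ((q - 1) * (n - m)) + 1"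
  proof -
    have "(q - 1) * n = (q - 1) * (n - m) + m * (q - 1)"
      using n_ge by (metis add_leD1 add_mult_distrib2 le_add_diff_inverse2 mult.commute)
    then have "card V \<le> (q - 1) * (n - m) + m * (q - 1) + 1" using cardV by simp
    then show ?thesis by (simp flip: of_nat_mult)
  qed
  finally show ?thesis by simp
qed

section \<open>Positive combinations of labels along a chain\<close>

text \<open>Injectivity of \<open>pos\<close> makes the first vertex unique, and a vertex lies in
  only one factor of a face.\<close>

lemma leader_singleton:
  assumes "F \<in> K" "F \<noteq> {}"
  obtains i where "i < q" "leader F = {i}"
proof -
  obtain p where p: "p \<in> F" "\<forall>p'\<in>F. pos (snd p) \<le> pos (snd p')"
    using assms ex_has_least_nat[of "\<lambda>p. p \<in> F" _ "\<lambda>p. pos (snd p)"] by blast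
  have "leader F = {fst p}"
  proof (intro set_eqI iffI)
    fix i assume "i \<in> leader F"
    then obtain v where v: "(i, v) \<in> F" "\<forall>p\<in>F. pos v \<le> pos (snd p)"
      by (auto simp: leader_def)
    then have "pos v = pos (snd p)" using p by force
    moreover have "v \<in> V" "snd p \<in> V" using v(1) p(1) assms(1) by (auto simp: K_iff)
    ultimately have "v = snd p" using pos_inj by (simp add: inj_on_eq_iff)
    then show "i \<in> {fst p}"
      using K_unique[OF assms(1) v(1), of "fst p"] p(1) by simp
  next
    fix i assume "i \<in> {fst p}"
    then show "i \<in> leader F"
      unfolding leader_def using p by (auto intro!: exI[of _ "snd p"])
  qed
  then show thesis
    using p(1) assms(1) by (intro that[of "fst p"]) (auto simp: K_iff)
qed

text \<open>Keeps the map away from 0: \<open>C\<close> will be the set of nonempty faces of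
  positive weight at a point.\<close>

lemma label_combination_not_constant:
  fixes w :: "(nat \<times> 'a) set \<Rightarrow> real"
  assumes C: "C \<subseteq> K - {{}}" "C \<noteq> {}" and w: "\<And>F. F \<in> C \<Longrightarrow> 0 < w F"
    and chain: "\<And>F F'. F \<in> C \<Longrightarrow> F' \<in> C \<Longrightarrow> F \<subseteq> F' \<or> F' \<subseteq> F"
  shows "\<exists>k<n. \<exists>i<q. \<exists>i'<q.
    (\<Sum>F\<in>C. w F * of_bool (i \<in> label k F)) \<noteq> (\<Sum>F\<in>C. w F * of_bool (i' \<in> label k F))"
proof (rule ccontr)
  assume "\<not> ?thesis"
  then have const: "(\<Sum>F\<in>C. w F * of_bool (i \<in> label k F)) = (\<Sum>F\<in>C. w F * of_bool (i' \<in> label k F))"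
    if "k < n" "i < q" "i' < q" for k i i'
    using that by blast
  have finC: "finite C"
    using C finite_K by (meson finite_Diff finite_subset)
  \<comment> \<open>A face that is not uniform has a proper nonempty \<open>big j F\<close>, which
    would make coordinate \<open>j\<close> nonconstant.\<close>
  have unif: "uniform F" if F: "F \<in> C" for F
    unfolding uniform_def
  proof (intro allI impI, rule ccontr)
    fix j assume j: "j < m" "\<not> (big j F = {} \<or> big j F = {..<q})"
    then obtain i i' where i: "i \<in> big j F" "i' < q" "i' \<notin> big j F"
      by (auto simp: big_def)
    have "(\<Sum>F\<in>C. w F * of_bool (i' \<in> big j F)) < (\<Sum>F\<in>C. w F * of_bool (i \<in> big j F))"
      by (rule monotone_indicator_combination_not_constant[where A = "big j" and w = w and G = F])
        (use finC w chain big_mono[OF j(1)] F i in auto)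
    moreover have "i < q" using i by (simp add: big_def)
    ultimately show False
      using const[of j i i'] j(1) n_ge i(2) by (simp add: label_def)
  qed
  obtain G where G: "G \<in> C" using C by auto
  \<comment> \<open>The block containing the rank of \<open>G\<close>; coordinate
    \<open>m + nat b\<close> therefore sees the leader of \<open>G\<close>.\<close>
  define b where "b = (rank G - 1) div int (q - 1)"
  have q1: "0 < int (q - 1)" using q_ge by simp
  have rG: "1 \<le> rank G" "rank G \<le> int ((q - 1) * (n - m))"
    using rank_pos rank_le unif[OF G] G C by auto
  have b0: "0 \<le> b"
    unfolding b_def using rG q1 by (simp add: pos_imp_zdiv_nonneg_iff)
  \<comment> \<open>The rank bound puts \<open>b\<close> among the \<open>n - m\<close> remaining
    coordinates.\<close>
  have "b < int (n - m)"
  proof -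
    have "b * int (q - 1) \<le> rank G - 1"
      unfolding b_def using q1 by (metis mult.commute pos_mod_sign mult_div_mod_eq le_add_same_cancel1)
    then have "b * int (q - 1) < int (n - m) * int (q - 1)"
      using rG(2) by (simp add: mult.commute del: of_nat_diff)
    then show ?thesis using q1 by (simp add: mult_less_cancel_right)
  qed
  then have k: "m + nat b < n" using b0 by linarith
  define B where "B = {F \<in> C. (rank F - 1) div int (q - 1) = b}"
  have lab: "label (m + nat b) F = (if F \<in> B then leader F else {})" if "F \<in> C" for F
    using that unif b0 by (auto simp: label_def B_def)
  have "inj_on rank B"
  proof (rule inj_onI)
    fix F F' assume F: "F \<in> B" "F' \<in> B" "rank F = rank F'"
    then have "F \<in> C" "F' \<in> C" by (auto simp: B_def)
    then show "F = F'"
      using chain[of F F'] rank_strict_mono[of F F'] rank_strict_mono[of F' F] unif C F(3) by auto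
  qed
  \<comment> \<open>Block \<open>b\<close> has only \<open>q - 1\<close> ranks, and faces in a chain
    of uniform faces have distinct ranks.\<close>
  moreover have "rank ` B \<subseteq> {b * int (q - 1) + 1 .. b * int (q - 1) + int (q - 1)}"
  proof (rule image_subsetI)
    fix F assume "F \<in> B"
    then have "b = (rank F - 1) div int (q - 1)" by (simp add: B_def)
    then have "rank F - 1 = b * int (q - 1) + (rank F - 1) mod int (q - 1)" by simp
    then show "rank F \<in> {b * int (q - 1) + 1 .. b * int (q - 1) + int (q - 1)}"
      using pos_mod_bound[OF q1, of "rank F - 1"] pos_mod_sign[OF q1, of "rank F - 1"]
      unfolding atLeastAtMost_iff by linarith
  qed
  ultimately have "card B \<le> card {b * int (q - 1) + 1 .. b * int (q - 1) + int (q - 1)}"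
    by (metis card_inj_on_le finite_atLeastAtMost_int)
  then have cardB: "card B \<le> q - 1" by simp
  have finB: "finite B" using finC by (simp add: B_def)
  have single: "card (leader F) = 1" if "F \<in> B" for F
    using that leader_singleton[of F] C by (force simp: B_def)
  \<comment> \<open>At most \<open>q - 1\<close> leaders cannot cover all \<open>q\<close> factors;
    a missed index \<open>i'\<close> gets sum 0, the leader of \<open>G\<close> a positive
    sum.\<close>
  have "card (\<Union>F\<in>B. leader F) \<le> (\<Sum>F\<in>B. card (leader F))"
    using card_UN_le[OF finB] .
  also have "\<dots> < q" using single cardB q_ge by simp
  finally have "\<not> {..<q} \<subseteq> (\<Union>F\<in>B. leader F)"
    using card_mono[of "\<Union>F\<in>B. leader F" "{..<q}"] finB single
    by (metis card.infinite card_lessThan finite_UN not_less zero_neq_one)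
  then obtain i' where i': "i' < q" "\<And>F. F \<in> B \<Longrightarrow> i' \<notin> leader F" by auto
  obtain i where i: "i < q" "leader G = {i}"
    using leader_singleton[of G] G C(1) by (metis DiffE insertI1 subsetD)
  have "(\<Sum>F\<in>C. w F * of_bool (i' \<in> label (m + nat b) F)) = 0"
    using lab i' by (intro sum.neutral) auto
  moreover have "0 < (\<Sum>F\<in>C. w F * of_bool (i \<in> label (m + nat b) F))"
  proof (rule sum_pos2[OF finC G])
    show "0 < w G * of_bool (i \<in> label (m + nat b) G)"
      using w[OF G] lab[OF G] G i by (simp add: B_def b_def)
    show "0 \<le> w F * of_bool (i \<in> label (m + nat b) F)" if "F \<in> C" for F
      using w[OF that] by simp
  qed
  ultimately show False
    using const[OF k i(1) i'(1)] by simp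
qed

section \<open>Equivariance of the labels\<close>

lemma big_permute:
  assumes "\<pi> permutes {..<q}"
  shows "i \<in> big j (permute_face \<pi> F) \<longleftrightarrow> inv \<pi> i \<in> big j F"
  using permutes_in_image[OF permutes_inv[OF assms], of i]
  by (simp add: big_def cnt_def Image_permute_face[OF assms])

lemma big_permute_eq:
  assumes "\<pi> permutes {..<q}"
  shows "big j (permute_face \<pi> F) = {} \<longleftrightarrow> big j F = {}"
    and "big j (permute_face \<pi> F) = {..<q} \<longleftrightarrow> big j F = {..<q}"
proof -
  have "big j (permute_face \<pi> F) = \<pi> ` big j F"
    using big_permute[OF assms] permutes_inverses[OF assms]
    by (auto simp: image_iff) metis
  moreover have "\<pi> ` {..<q} = {..<q}" using permutes_image[OF assms] .
  ultimately show "big j (permute_face \<pi> F) = {} \<longleftrightarrow> big j F = {}"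
    and "big j (permute_face \<pi> F) = {..<q} \<longleftrightarrow> big j F = {..<q}"
    using inj_image_eq_iff[OF permutes_inj[OF assms]] by (simp, metis)
qed

lemma rank_permute:
  assumes "\<pi> permutes {..<q}"
  shows "rank (permute_face \<pi> F) = rank F"
proof -
  have "(\<Sum>i<q. cnt j i (permute_face \<pi> F)) = (\<Sum>i<q. cnt j i F)" for j
    using sum.reindex_bij_betw[OF permutes_imp_bij[OF permutes_inv[OF assms]], of "\<lambda>i. cnt j i F"]
    by (simp add: cnt_def Image_permute_face[OF assms])
  then show ?thesis
    by (simp add: rank_def slice_rank_def big_permute_eq[OF assms] del: of_nat_sum)
qed

lemma label_permute:
  assumes "\<pi> permutes {..<q}"
  shows "i \<in> label k (permute_face \<pi> F) \<longleftrightarrow> inv \<pi> i \<in> label k F"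
proof -
  have "i \<in> leader (permute_face \<pi> F) \<longleftrightarrow> inv \<pi> i \<in> leader F"
    unfolding leader_def mem_Collect_eq mem_permute_face[OF assms]
    by (simp add: permute_face_def)
  moreover have "uniform (permute_face \<pi> F) \<longleftrightarrow> uniform F"
    by (simp add: uniform_def big_permute_eq[OF assms])
  ultimately show ?thesis
    by (simp add: label_def big_permute[OF assms] rank_permute[OF assms])
qed

lemma permute_face_K:
  assumes "\<pi> permutes {..<q}" "F \<in> K"
  shows "permute_face \<pi> F \<in> K"
  unfolding K_iff
proof (intro conjI allI impI)
  show "permute_face \<pi> F \<subseteq> {..<q} \<times> V"
    using assms permutes_in_image[OF assms(1)] by (auto simp: permute_face_def K_iff)
  show "independent_set E (permute_face \<pi> F `` {i})" if "i < q" for i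
    using assms that permutes_in_image[OF permutes_inv[OF assms(1)], of i]
    by (simp add: Image_permute_face[OF assms(1)] K_iff)
  show "inj_on snd (permute_face \<pi> F)"
    using assms(2) by (force simp: permute_face_def K_iff inj_on_def)
qed

text \<open>Used to reindex the sum over faces in \<open>amount\<close>.\<close>

lemma bij_betw_permute_face:
  assumes "\<pi> permutes {..<q}"
  shows "bij_betw (permute_face \<pi>) (K - {{}}) (K - {{}})"
proof (rule bij_betw_byWitness[where f' = "permute_face (inv \<pi>)"])
  have inverse: "permute_face (inv \<rho>) (permute_face \<rho> F) = F" if "\<rho> permutes {..<q}"
    for \<rho> :: "nat \<Rightarrow> nat" and F :: "(nat \<times> 'a) set"
    by (simp add: permute_face_def image_image map_prod_def case_prod_unfold permutes_inverses[OF that])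
  show "\<forall>F\<in>K - {{}}. permute_face (inv \<pi>) (permute_face \<pi> F) = F"
    using inverse[OF assms] by blast
  show "\<forall>F\<in>K - {{}}. permute_face \<pi> (permute_face (inv \<pi>) F) = F"
    using inverse[OF permutes_inv[OF assms]] permutes_inv_inv[OF assms] by simp
  show "permute_face \<pi> ` (K - {{}}) \<subseteq> K - {{}}"
    using permute_face_K[OF assms] by (auto simp: permute_face_def)
  show "permute_face (inv \<pi>) ` (K - {{}}) \<subseteq> K - {{}}"
    using permute_face_K[OF permutes_inv[OF assms]] by (auto simp: permute_face_def)
qed

section \<open>The equivariant map on the realization\<close>

text \<open>
  The faces of positive weight are superlevel sets of the barycentric coordinates, hence form a
  chain; up to scaling, the weights are coordinates on the barycentric subdivision.
\<close>
definition weight :: "(nat \<times> 'a) set \<Rightarrow> (nat \<times> 'a \<Rightarrow> real) \<Rightarrow> real" where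
  "weight F x = (\<Prod>p\<in>F. x p * (\<Prod>p'\<in>{..<q} \<times> V - F. max 0 (x p - x p')))"

definition amount :: "(nat \<times> 'a \<Rightarrow> real) \<Rightarrow> nat \<Rightarrow> nat \<Rightarrow> real" where
  "amount x k i = (\<Sum>F\<in>K - {{}}. weight F x * of_bool (i \<in> label k F))"

text \<open>Subtracting the mean projects each \<open>amount x k\<close> orthogonally onto
  \<open>W_rep q\<close>, with kernel the constant vectors; the value 0 elsewhere matches the
  encoding of \<open>W_rep_sum\<close>.\<close>

definition test :: "(nat \<times> 'a \<Rightarrow> real) \<Rightarrow> nat \<Rightarrow> nat \<Rightarrow> real" where
  "test x k i = (if k < n \<and> i < q then amount x k i - (\<Sum>i'<q. amount x k i') / q else 0)"

definition test_norm :: "(nat \<times> 'a \<Rightarrow> real) \<Rightarrow> real" where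
  "test_norm x = sqrt (\<Sum>k<n. \<Sum>i<q. (test x k i)\<^sup>2)"

lemma weight_nonneg: "(\<And>p. 0 \<le> x p) \<Longrightarrow> 0 \<le> weight F x"
  unfolding weight_def by (intro prod_nonneg ballI mult_nonneg_nonneg) auto

text \<open>A product of nonnegative factors is positive iff no factor vanishes; the maximum with 0
  kills the weight unless \<open>F\<close> is a strict superlevel set.\<close>

lemma weight_pos_iff:
  assumes "\<And>p. 0 \<le> x p" "finite F"
  shows "0 < weight F x \<longleftrightarrow> (\<forall>p\<in>F. 0 < x p \<and> (\<forall>p'\<in>{..<q} \<times> V - F. x p' < x p))"
proof -
  have "0 < weight F x \<longleftrightarrow> weight F x \<noteq> 0"
    using weight_nonneg[of x F] assms(1) by (simp add: less_le)
  also have "\<dots> \<longleftrightarrow> (\<forall>p\<in>F. x p \<noteq> 0 \<and> (\<forall>p'\<in>{..<q} \<times> V - F. max 0 (x p - x p') \<noteq> 0))"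
    using assms(2) finV by (auto simp: weight_def)
  also have "\<dots> \<longleftrightarrow> (\<forall>p\<in>F. 0 < x p \<and> (\<forall>p'\<in>{..<q} \<times> V - F. x p' < x p))"
  proof -
    have "x p \<noteq> 0 \<longleftrightarrow> 0 < x p" for p using assms(1)[of p] by auto
    moreover have "max 0 (x p - x p') \<noteq> 0 \<longleftrightarrow> x p' < x p" for p p' by auto
    ultimately show ?thesis by simp
  qed
  finally show ?thesis .
qed

lemma weight_permute:
  assumes "\<pi> permutes {..<q}"
  shows "weight (permute_face \<pi> F) (permute_factors \<pi> x) = weight F x"
proof -
  have inj: "inj_on (map_prod \<pi> id) A" for A :: "(nat \<times> 'a) set"
    using inj_map_prod_permutes[OF assms] by (rule inj_on_subset) simp
  have "map_prod \<pi> id ` ({..<q} \<times> V) = {..<q} \<times> V"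
    using permutes_image[OF assms] by (simp add: map_prod_surj_on)
  then have "{..<q} \<times> V - permute_face \<pi> F = map_prod \<pi> id ` ({..<q} \<times> V - F)"
    using image_set_diff[OF inj_map_prod_permutes[OF assms], of "{..<q} \<times> V" F]
    by (simp add: permute_face_def)
  then show ?thesis
    unfolding weight_def
    by (simp add: permute_face_def prod.reindex[OF inj] permute_factors_map_prod[OF assms])
qed

lemma amount_permute:
  assumes "\<pi> permutes {..<q}"
  shows "amount (permute_factors \<pi> x) k i = amount x k (inv \<pi> i)"
  unfolding amount_def
  by (subst sum.reindex_bij_betw[OF bij_betw_permute_face[OF assms], symmetric])
    (simp add: weight_permute[OF assms] label_permute[OF assms])

lemma test_permute:
  assumes "\<pi> permutes {..<q}"
  shows "test (permute_factors \<pi> x) k i = test x k (inv \<pi> i)"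
proof -
  have "(\<Sum>i<q. amount x k (inv \<pi> i)) = (\<Sum>i<q. amount x k i)"
    by (rule sum.reindex_bij_betw[OF permutes_imp_bij[OF permutes_inv[OF assms]]])
  then show ?thesis
    using permutes_in_image[OF permutes_inv[OF assms], of i]
    by (simp add: test_def amount_permute[OF assms])
qed

lemma test_norm_permute:
  assumes "\<pi> permutes {..<q}"
  shows "test_norm (permute_factors \<pi> x) = test_norm x"
proof -
  have "(\<Sum>i<q. (test x k (inv \<pi> i))\<^sup>2) = (\<Sum>i<q. (test x k i)\<^sup>2)" for k
    by (rule sum.reindex_bij_betw[OF permutes_imp_bij[OF permutes_inv[OF assms]]])
  then show ?thesis
    by (simp add: test_norm_def test_permute[OF assms])
qed

lemma test_norm_pos:
  assumes "x \<in> geometric_realization K"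
  shows "0 < test_norm x"
proof -
  define D where "D = {p. x p \<noteq> 0}"
  have x: "\<And>p. 0 \<le> x p" "D \<in> K" "sum x D = 1"
    using assms by (auto simp: geometric_realization_def D_def)
  have fin: "finite F" if "F \<in> K" for F
    using that finV by (auto simp: K_iff intro: finite_subset)
  have D: "finite D" "D \<noteq> {}" using fin x by auto
  define C where "C = {F \<in> K - {{}}. 0 < weight F x}"
  \<comment> \<open>The top level set of \<open>x\<close> has positive weight, so \<open>C\<close>
    is nonempty.\<close>
  define F0 where "F0 = {p \<in> D. x p = Max (x ` D)}"
  have "F0 \<in> C"
  proof -
    have "Max (x ` D) \<in> x ` D" using D by (intro Max_in) auto
    then obtain p where "p \<in> D" "Max (x ` D) = x p" by blast
    then have "p \<in> F0" by (simp add: F0_def)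
    then have ne: "F0 \<noteq> {}" by blast
    have F0K: "F0 \<in> K" using K_subset[OF x(2)] by (auto simp: F0_def)
    have "x p' < x p" if "p \<in> F0" "p' \<notin> F0" for p p'
    proof (cases "p' \<in> D")
      case True
      then have "x p' \<le> Max (x ` D)" "x p' \<noteq> Max (x ` D)"
        using that D by (simp_all add: F0_def)
      then show ?thesis using that by (simp add: F0_def)
    next
      case False
      then show ?thesis
        using that x(1)[of p] by (auto simp: F0_def D_def less_le)
    qed
    moreover have "0 < x p" if "p \<in> F0" for p
      using that x(1)[of p] by (auto simp: F0_def D_def less_le)
    ultimately have "0 < weight F0 x"
      using weight_pos_iff[of x F0] x(1) fin[OF F0K] by blast
    then show ?thesis using ne F0K by (simp add: C_def)
  qed
  \<comment> \<open>Incomparable superlevel sets would give two coordinates each strictly larger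
    than the other.\<close>
  moreover have "F \<subseteq> F' \<or> F' \<subseteq> F" if F: "F \<in> C" "F' \<in> C" for F F'
  proof (rule ccontr)
    assume "\<not> ?thesis"
    then obtain p p' where p: "p \<in> F" "p \<notin> F'" "p' \<in> F'" "p' \<notin> F" by auto
    have U: "p \<in> {..<q} \<times> V" "p' \<in> {..<q} \<times> V"
      using p F by (auto simp: C_def K_iff)
    have "x p' < x p"
      using F(1) p U weight_pos_iff[of x F] x(1) fin by (auto simp: C_def)
    moreover have "x p < x p'"
      using F(2) p U weight_pos_iff[of x F'] x(1) fin by (auto simp: C_def)
    ultimately show False by simp
  qed
  ultimately obtain k i i' where k: "k < n" "i < q" "i' < q"
    and ne: "(\<Sum>F\<in>C. weight F x * of_bool (i \<in> label k F)) \<noteq>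
      (\<Sum>F\<in>C. weight F x * of_bool (i' \<in> label k F))"
    using label_combination_not_constant[of C "\<lambda>F. weight F x"] by (fastforce simp: C_def)
  have "amount x k i = (\<Sum>F\<in>C. weight F x * of_bool (i \<in> label k F))" for i
    unfolding amount_def C_def
    by (rule sum.mono_neutral_right)
      (use finite_K weight_nonneg[of x] x(1) in \<open>auto simp: less_le\<close>)
  \<comment> \<open>Both entries lose the same mean, so they still differ and cannot both be
    0.\<close>
  then have "test x k i \<noteq> test x k i'"
    using ne k by (simp add: test_def)
  then obtain i0 where i0: "i0 < q" "test x k i0 \<noteq> 0"
    using k by metis
  have "0 < (\<Sum>i<q. (test x k i)\<^sup>2)"
    using i0 by (intro sum_pos2[of _ i0]) auto
  then have "0 < (\<Sum>k<n. \<Sum>i<q. (test x k i)\<^sup>2)"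
    by (rule sum_pos2[of _ k, rotated 2]) (use k in \<open>auto intro: sum_nonneg\<close>)
  then show ?thesis by (simp add: test_norm_def)
qed

text \<open>Normalising \<open>test\<close> is continuous because its norm is positive on the
  realization, and equivariant because the norm is invariant.\<close>

lemma equivariant_map_exists:
  "sym_equivariant_map q permute_factors (geometric_realization K)
     permute_coords (W_sphere q n) (\<lambda>x k i. test x k i / test_norm x)"
  unfolding sym_equivariant_map_def
proof (intro conjI allI impI ballI funcsetI)
  have cont_test: "continuous_on S (\<lambda>x. test x k i)" for S k i
  proof (cases "k < n \<and> i < q")
    case True
    have coord: "continuous_on S (\<lambda>x. x p)" for p :: "nat \<times> 'a" and S :: "(nat \<times> 'a \<Rightarrow> real) set"
      by (rule continuous_on_product_then_coordinatewise[OF continuous_on_id])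
    show ?thesis
      using True q_ge unfolding test_def amount_def weight_def
      by (auto intro!: continuous_intros coord)
  qed (auto simp: test_def)
  show "continuous_on (geometric_realization K) (\<lambda>x k i. test x k i / test_norm x)"
  proof (intro continuous_on_coordinatewise_then_product continuous_on_divide cont_test ballI)
    show "continuous_on (geometric_realization K) test_norm"
      unfolding test_norm_def by (intro continuous_intros cont_test)
    show "test_norm x \<noteq> 0" if "x \<in> geometric_realization K" for x
      using test_norm_pos[OF that] by simp
  qed
next
  fix x assume "x \<in> geometric_realization K"
  then have pos: "0 < test_norm x" by (rule test_norm_pos)
  have "(\<Sum>i<q. test x k i) = 0" if "k < n" for k
    using that q_ge by (simp add: test_def sum_subtractf)
  then have W: "(\<lambda>k i. test x k i / test_norm x) \<in> W_rep_sum q n"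
    by (auto simp: W_rep_sum_def W_rep_def test_def simp flip: sum_divide_distrib)
  have "(\<Sum>k<n. \<Sum>i<q. (test x k i / test_norm x)\<^sup>2) =
      (\<Sum>k<n. \<Sum>i<q. (test x k i)\<^sup>2) / (test_norm x)\<^sup>2"
    by (simp add: power_divide sum_divide_distrib)
  also have "(test_norm x)\<^sup>2 = (\<Sum>k<n. \<Sum>i<q. (test x k i)\<^sup>2)"
    unfolding test_norm_def by (intro real_sqrt_pow2 sum_nonneg) auto
  finally have "(\<Sum>k<n. \<Sum>i<q. (test x k i / test_norm x)\<^sup>2) = 1"
    using pos by (auto simp: test_norm_def)
  then show "(\<lambda>k i. test x k i / test_norm x) \<in> W_sphere q n"
    using W by (simp add: W_sphere_def)
next
  fix \<pi> x assume "\<pi> permutes {..<q}"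
  then show "(\<lambda>k i. test (permute_factors \<pi> x) k i / test_norm (permute_factors \<pi> x)) =
      permute_coords \<pi> (\<lambda>k i. test x k i / test_norm x)"
    by (simp add: permute_coords_def test_permute test_norm_permute)
qed

end

section \<open>Contradiction with the absence of an equivariant map\<close>

theorem theorem1p2:
  fixes V :: "'a set" and E :: "'a set set" and P :: "nat \<Rightarrow> 'a set" and m n q :: nat
  assumes "finite_graph V E"
    and "(\<Union>j<m. P j) = V" and "disjoint_family_on P {..<m}"
    and "n \<ge> m + 1" and "q \<ge> 2"
    and "\<forall>j<m. card (P j) \<ge> q - 1"
    and "card V \<le> (q - 1) * n + 1"
    and "\<not> (\<exists>f. sym_equivariant_map q
               permute_factors (geometric_realization (deleted_join q (independence_complex V E)))
               permute_coords (W_sphere q n) f)"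
  shows "\<exists>S. (\<forall>i<q. independent_set E (S i)) \<and> almost_fair_splitting V m P q S"
proof (rule ccontr)
  assume no_splitting: "\<not> ?thesis"
  have finV: "finite V"
    using assms(1) by (simp add: finite_graph_def)
  obtain pos :: "'a \<Rightarrow> nat" where "inj_on pos V"
    using finite_imp_inj_to_nat_seg[OF finV] by blast
  then interpret partitioned_graph V E P m n q pos
    using finV assms(2-7) no_splitting by unfold_locales
  show False
    using equivariant_map_exists assms(8) by (auto simp: K_def)
qed

end
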